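(* Let $G$ be a normal mixed lattice group such that one of the following conditions holds. (a) $G_{sp}\subseteq G_p$ and $G$ is $(\leq)$-Archimedean. (b) $G_{p}\subseteq G_{sp}$ and $G$ is $(\preccurlyeq)$-Archimedean. Then every nonzero element of $G$ has infinite order.
   Context: $\mathbb{N}=\{1,2,3,\dots\}$. A mixed lattice group is an abelian group $(G,+)$ with two partial orders $\leq$ and $\preccurlyeq$, each compatible with addition ($u\leq v$ implies $u+w\leq v+w$, and likewise for $\preccurlyeq$), such that the mixed envelopes $x\curlyvee y=\min\{w\in G: w\succcurlyeq x \text{ and } w\geq y\}$ and $x\curlywedge y=\max\{w\in G: w\preccurlyeq x \text{ and } w\leq y\}$ (minimum and maximum with respect to $\leq$) exist for all $x,y\in G$. Notation: $G_p=\{w\in G: w\geq 0\}$, $G_{sp}=\{w\in G: w\succcurlyeq 0\}$. $G$ is normal if $G_{sp}\subseteq G_p$ or $G_p\subseteq G_{sp}$. $G$ is $(\leq)$-Archimedean if, for all $x,y\in G$, $nx\leq y$ for all $n\in\mathbb{N}$ implies $x\leq 0$. $G$ is $(\preccurlyeq)$-Archimedean if, for all $x,y\in G$, $nx\preccurlyeq y$ for all $n\in\mathbb{N}$ implies $x\preccurlyeq 0$. *)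

theory Defs
  imports Main
begin

definition nmult :: "nat \<Rightarrow> 'a::ab_group_add \<Rightarrow> 'a"
  where "nmult n x = (\<Sum>i<n. x)"

text \<open>The two orders of a mixed lattice group are explicit relations on the type of group
  elements, so that notions such as cones and the Archimedean property are defined once, for
  an arbitrary relation.\<close>

locale partially_ordered_group =
  fixes r :: "'a::ab_group_add \<Rightarrow> 'a \<Rightarrow> bool"
  assumes refl: "reflp r"
    and antisym: "antisymp r"
    and trans: "transp r"
    and translation: "r u v \<Longrightarrow> r (u + w) (v + w)"

definition is_minimum :: "('a \<Rightarrow> 'a \<Rightarrow> bool) \<Rightarrow> 'a set \<Rightarrow> 'a \<Rightarrow> bool"
  where "is_minimum r S m \<longleftrightarrow> m \<in> S \<and> (\<forall>w\<in>S. r m w)"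

definition is_maximum :: "('a \<Rightarrow> 'a \<Rightarrow> bool) \<Rightarrow> 'a set \<Rightarrow> 'a \<Rightarrow> bool"
  where "is_maximum r S m \<longleftrightarrow> m \<in> S \<and> (\<forall>w\<in>S. r w m)"

text \<open>Both envelopes are extremal with respect to the first order \<open>le\<close>; the specific order
  \<open>sle\<close> enters only through the bound by the left argument.\<close>

locale mixed_lattice_group =
  le: partially_ordered_group le + sle: partially_ordered_group sle
  for le sle :: "'a::ab_group_add \<Rightarrow> 'a \<Rightarrow> bool" +
  assumes upper_envelope_exists: "\<exists>m. is_minimum le {w. sle x w \<and> le y w} m"
    and lower_envelope_exists: "\<exists>m. is_maximum le {w. sle w x \<and> le w y} m"

definition positive_cone :: "('a::ab_group_add \<Rightarrow> 'a \<Rightarrow> bool) \<Rightarrow> 'a set"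
  where "positive_cone r = {w. r 0 w}"

definition normal_orders :: "('a::ab_group_add \<Rightarrow> 'a \<Rightarrow> bool) \<Rightarrow> ('a \<Rightarrow> 'a \<Rightarrow> bool) \<Rightarrow> bool"
  where "normal_orders le sle \<longleftrightarrow>
    positive_cone sle \<subseteq> positive_cone le \<or> positive_cone le \<subseteq> positive_cone sle"

definition archimedean_wrt :: "('a::ab_group_add \<Rightarrow> 'a \<Rightarrow> bool) \<Rightarrow> bool"
  where "archimedean_wrt r \<longleftrightarrow> (\<forall>x y. (\<forall>n\<ge>1. r (nmult n x) y) \<longrightarrow> r x 0)"

definition infinite_order :: "'a::ab_group_add \<Rightarrow> bool"
  where "infinite_order x \<longleftrightarrow> \<not> (\<exists>n\<ge>1. nmult n x = 0)"

end

theory Submission imports Defs begin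

text \<open>In each of the two cases, one order \<open>r\<close> contains the other, namely the order that is
  assumed to be Archimedean. An element of the set \<open>{w. sle x w \<and> le y w}\<close>, whose minimum is the
  upper envelope, is then an \<open>r\<close>-upper bound of both \<open>x\<close> and \<open>y\<close>, so \<open>r\<close> is directed
  (\<open>directed_if_cone_inclusion\<close>). A torsion element has only finitely many
  distinct multiples, and directedness bounds all of them by one element; the Archimedean
  property gives \<open>r x 0\<close> (\<open>torsion_imp_nonpositive\<close>). The inverse of a torsion element is again
  a torsion element, so also \<open>r (- x) 0\<close>, and antisymmetry yields \<open>x = 0\<close>.\<close>

lemma nmult_uminus: "nmult n (- x) = - nmult n x"
  by (simp add: nmult_def sum_negf)

lemma nmult_add: "nmult (m + n) x = nmult m x + nmult n x"
  by (induction n) (simp_all add: nmult_def algebra_simps)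

lemma nmult_mod:
  assumes "nmult p x = 0"
  shows "nmult (n mod p) x = nmult n x"
proof -
  have "nmult (q * p) x = 0" for q
    by (induction q) (simp_all add: nmult_add assms, simp add: nmult_def)
  then have "nmult (n div p * p + n mod p) x = nmult (n mod p) x"
    by (simp only: nmult_add add_0_left)
  then show ?thesis by simp
qed

context partially_ordered_group
begin

lemma le_iff_diff: "r u v \<longleftrightarrow> r 0 (v - u)"
  using translation[of u v "- u"] translation[of 0 "v - u" u] by auto

lemma directed_finite_bound:
  assumes directed: "\<And>x y. \<exists>w. r x w \<and> r y w" and "finite S"
  shows "\<exists>w. \<forall>s\<in>S. r s w"
  using \<open>finite S\<close>
proof (induction S rule: finite_induct)
  case empty
  then show ?case by simp
next
  case (insert a S)
  then obtain w where w: "\<forall>s\<in>S. r s w" by blast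
  obtain v where "r a v" "r w v" using directed by blast
  then show ?case using w transpD[OF trans _ \<open>r w v\<close>] by blast
qed

text \<open>Reduction of the multiplier modulo \<open>p\<close> turns an upper bound of the first \<open>p\<close> multiples
  into an upper bound of all of them, to which the Archimedean property applies.\<close>

lemma torsion_imp_nonpositive:
  assumes directed: "\<And>x y. \<exists>w. r x w \<and> r y w"
    and arch: "archimedean_wrt r"
    and "p \<ge> 1" and torsion: "nmult p x = 0"
  shows "r x 0"
proof -
  obtain w where w: "\<forall>s\<in>(\<lambda>k. nmult k x) ` {..<p}. r s w"
    using directed_finite_bound[OF directed] by blast
  have "r (nmult n x) w" for n
  proof -
    have "n mod p < p" using \<open>p \<ge> 1\<close> by simp
    then have "r (nmult (n mod p) x) w" using w by blast
    then show ?thesis by (simp only: nmult_mod[OF torsion])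
  qed
  then show ?thesis using arch unfolding archimedean_wrt_def by blast
qed

lemma directed_archimedean_imp_infinite_order:
  fixes x :: 'a
  assumes directed: "\<And>x y. \<exists>w. r x w \<and> r y w"
    and arch: "archimedean_wrt r" and "x \<noteq> 0"
  shows "infinite_order x"
  unfolding infinite_order_def
proof
  assume "\<exists>n\<ge>1. nmult n x = 0"
  then obtain p where p: "p \<ge> 1" "nmult p x = 0" by blast
  have "r x 0"
    using torsion_imp_nonpositive[OF directed arch p] .
  moreover have "r (- x) 0"
    using torsion_imp_nonpositive[OF directed arch, of p "- x"] p by (simp add: nmult_uminus)
  then have "r 0 x" using le_iff_diff[of "- x" 0] by simp
  ultimately show False using antisympD[OF antisym] \<open>x \<noteq> 0\<close> by blast
qed

end

text \<open>Translation invariance lifts an inclusion of cones to an inclusion of the orders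
  themselves, so the order with the larger cone inherits both halves of a mixed bound.\<close>

lemma positive_cone_subset_imp_le:
  assumes "partially_ordered_group r" and "partially_ordered_group s"
    and "positive_cone r \<subseteq> positive_cone s" and "r u v"
  shows "s u v"
  using assms partially_ordered_group.le_iff_diff[of r u v]
    partially_ordered_group.le_iff_diff[of s u v]
  by (auto simp: positive_cone_def)

lemma directed_if_cone_inclusion:
  assumes "mixed_lattice_group le sle" and "partially_ordered_group r"
    and "positive_cone le \<subseteq> positive_cone r" and "positive_cone sle \<subseteq> positive_cone r"
  shows "\<exists>w. r x w \<and> r y w"
proof -
  interpret mixed_lattice_group le sle by fact
  obtain w where "sle x w" "le y w"
    using upper_envelope_exists[of x y] by (auto simp: is_minimum_def)
  then show ?thesis
    using positive_cone_subset_imp_le[OF le.partially_ordered_group_axioms assms(2,3)]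
      positive_cone_subset_imp_le[OF sle.partially_ordered_group_axioms assms(2,4)]
    by blast
qed

theorem theorem4p3:
  fixes le sle :: "'a::ab_group_add \<Rightarrow> 'a \<Rightarrow> bool"
  assumes "mixed_lattice_group le sle"
    and "normal_orders le sle"
    and "(positive_cone sle \<subseteq> positive_cone le \<and> archimedean_wrt le) \<or>
         (positive_cone le \<subseteq> positive_cone sle \<and> archimedean_wrt sle)"
  shows "\<forall>x::'a. x \<noteq> 0 \<longrightarrow> infinite_order x"
proof -
  interpret mixed_lattice_group le sle by fact
  show ?thesis
    using assms(3)
  proof (elim disjE conjE)
    assume cone: "positive_cone sle \<subseteq> positive_cone le" and arch: "archimedean_wrt le"
    show ?thesis
      using le.directed_archimedean_imp_infinite_order[OF directed_if_cone_inclusion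
          [OF assms(1) le.partially_ordered_group_axioms subset_refl cone] arch]
      by blast
  next
    assume cone: "positive_cone le \<subseteq> positive_cone sle" and arch: "archimedean_wrt sle"
    show ?thesis
      using sle.directed_archimedean_imp_infinite_order[OF directed_if_cone_inclusion
          [OF assms(1) sle.partially_ordered_group_axioms cone subset_refl] arch]
      by blast
  qed
qed

end
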